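(* Let $G\in O_n$, let $A$ be a nonzero real skew symmetric matrix of order $n$, and let $\pm \mathbf{i}\zeta_1,\dots,\pm \mathbf{i}\zeta_s$ (with $\zeta_1,\dots,\zeta_s>0$ distinct) be the distinct nonzero eigenvalues of $A$, with Singular Value Decomposition $A=\sum_{j=1}^s\zeta_jA_j$. Let $$\alpha(t)=G\exp(tA)=G+\sum_{j=1}^s\left[\sin(t\zeta_j)\,GA_j+(1-\cos(t\zeta_j))\,GA_j^2\right],\qquad t\in\mathbb{R},$$ be the corresponding nonconstant geodesic of $(O_n,g)$. Then: a) if there exist $j,h\in\{1,\dots,s\}$ such that $\dfrac{\zeta_j}{\zeta_h}\notin\mathbb{Q}$, then $t\mapsto\alpha(t)$ is an injective immersion of $\mathbb{R}$ into $O_n$; b) if $\dfrac{\zeta_j}{\zeta_h}\in\mathbb{Q}$ for every $j,h\in\{1,\dots,s\}$, then $\alpha(t)$ is a closed (i.e. periodic) geodesic of $(O_n,g)$.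
   Context: $O_n$ is the group of real orthogonal matrices of order $n$ with the Riemannian metric $g(V,W)=\operatorname{tr}(V^TW)$. The Singular Value Decomposition of a nonzero real skew symmetric matrix $A$ is its unique expression $A=\sum_{j=1}^s\zeta_jA_j$ with $\zeta_j>0$ its distinct nonzero singular values and $A_j$ nonzero real skew symmetric matrices with $A_j^3=-A_j$ for every $j$ and $A_jA_h=0$ for $j\ne h$. *)

theory Defs
  imports "HOL-Analysis.Analysis"
begin

definition skew_symmetric :: "real^'n^'n \<Rightarrow> bool" where
  "skew_symmetric A \<longleftrightarrow> transpose A = - A"

definition eigenvalue :: "'a::field^'n^'n \<Rightarrow> 'a \<Rightarrow> bool" where
  "eigenvalue A c \<longleftrightarrow> (\<exists>v. v \<noteq> 0 \<and> A *v v = c *s v)"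

abbreviation complexify :: "real^'n^'n \<Rightarrow> complex^'n^'n" where
  "complexify \<equiv> map_matrix complex_of_real"

definition singular_value :: "real^'n^'n \<Rightarrow> real \<Rightarrow> bool" where
  "singular_value A z \<longleftrightarrow> z \<ge> 0 \<and> eigenvalue (transpose A ** A) (z\<^sup>2)"

definition skew_svd ::
  "real^'n^'n \<Rightarrow> nat \<Rightarrow> (nat \<Rightarrow> real) \<Rightarrow> (nat \<Rightarrow> real^'n^'n) \<Rightarrow> bool" where
  "skew_svd A s z B \<longleftrightarrow>
     inj_on z {1..s} \<and>
     z ` {1..s} = {c. singular_value A c \<and> c \<noteq> 0} \<and>
     (\<forall>j\<in>{1..s}. B j \<noteq> 0 \<and> skew_symmetric (B j) \<and> B j ** B j ** B j = - B j) \<and>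
     (\<forall>j\<in>{1..s}. \<forall>h\<in>{1..s}. j \<noteq> h \<longrightarrow> B j ** B h = 0) \<and>
     A = (\<Sum>j=1..s. z j *\<^sub>R B j)"

text \<open>The type of square matrices carries no ring structure for the matrix product \<open>**\<close>, so
  the library's \<open>exp\<close> and \<open>^\<close> do not apply. The series below converges for every matrix.\<close>

primrec matrix_power :: "real^'n^'n \<Rightarrow> nat \<Rightarrow> real^'n^'n" where
  "matrix_power A 0 = mat 1"
| "matrix_power A (Suc k) = A ** matrix_power A k"

definition matrix_exp :: "real^'n^'n \<Rightarrow> real^'n^'n" where
  "matrix_exp A = (\<Sum>k. (1 / fact k) *\<^sub>R matrix_power A k)"

definition orthogonal_group :: "(real^'n^'n) set" where
  "orthogonal_group = {Q. orthogonal_matrix Q}"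

definition frobenius_metric :: "real^'n^'n \<Rightarrow> real^'n^'n \<Rightarrow> real" where
  "frobenius_metric V W = trace (transpose V ** W)"

text \<open>Below, \<open>M\<close> is an embedded submanifold of a Euclidean space, so a curve is smooth into
  \<open>M\<close> iff it is smooth into the ambient space and takes its values in \<open>M\<close>.
  The sequence \<open>d\<close> consists of the successive derivatives of \<open>c\<close> on the open set \<open>I\<close>.\<close>

definition smooth_curve_in :: "'a::euclidean_space set \<Rightarrow> real set \<Rightarrow> (real \<Rightarrow> 'a) \<Rightarrow> bool" where
  "smooth_curve_in M I c \<longleftrightarrow>
     open I \<and> c ` I \<subseteq> M \<and>
     (\<exists>d :: nat \<Rightarrow> real \<Rightarrow> 'a. d 0 = c \<and>
        (\<forall>k. \<forall>t\<in>I. (d k has_vector_derivative d (Suc k) t) (at t)))"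

definition tangent_space :: "'a::euclidean_space set \<Rightarrow> 'a \<Rightarrow> 'a set" where
  "tangent_space M p =
     {v. \<exists>c e. e > 0 \<and> smooth_curve_in M {-e<..<e} c \<and> c 0 = p \<and>
           (c has_vector_derivative v) (at 0)}"

text \<open>The Riemannian metric on \<open>M\<close> is the restriction of a constant inner product \<open>g\<close> on the
  ambient space, which is flat. Hence the Levi-Civita covariant derivative of a tangent vector
  field \<open>X\<close> along a curve \<open>c\<close> in \<open>M\<close> is the \<open>g\<close>-orthogonal projection of the ordinary
  derivative of \<open>X\<close> onto the tangent space.\<close>

definition covariant_derivative ::
  "'a::euclidean_space set \<Rightarrow> ('a \<Rightarrow> 'a \<Rightarrow> real) \<Rightarrow> (real \<Rightarrow> 'a) \<Rightarrow> (real \<Rightarrow> 'a) \<Rightarrow> real \<Rightarrow> 'a" where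
  "covariant_derivative M g c X t =
     (THE w. w \<in> tangent_space M (c t) \<and>
        (\<forall>u\<in>tangent_space M (c t). g (vector_derivative X (at t) - w) u = 0))"

definition geodesic :: "'a::euclidean_space set \<Rightarrow> ('a \<Rightarrow> 'a \<Rightarrow> real) \<Rightarrow> (real \<Rightarrow> 'a) \<Rightarrow> bool" where
  "geodesic M g c \<longleftrightarrow>
     smooth_curve_in M UNIV c \<and>
     (\<forall>t. covariant_derivative M g c (\<lambda>r. vector_derivative c (at r)) t = 0)"

definition closed_geodesic ::
  "'a::euclidean_space set \<Rightarrow> ('a \<Rightarrow> 'a \<Rightarrow> real) \<Rightarrow> (real \<Rightarrow> 'a) \<Rightarrow> bool" where
  "closed_geodesic M g c \<longleftrightarrow> geodesic M g c \<and> (\<exists>T>0. \<forall>t. c (t + T) = c t)"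

definition injective_immersion :: "'a::euclidean_space set \<Rightarrow> (real \<Rightarrow> 'a) \<Rightarrow> bool" where
  "injective_immersion M c \<longleftrightarrow>
     smooth_curve_in M UNIV c \<and> (\<forall>t. inj (frechet_derivative c (at t))) \<and> inj c"

end

theory Submission
  imports Defs
begin

text \<open>
  The relations \<open>B j ** B j ** B j = - B j\<close> and \<open>B j ** B h = 0\<close> turn the exponential series into
  sine and cosine series, one for each singular value. The curve \<open>\<alpha>\<close> solves \<open>\<alpha>' = \<alpha> A\<close>, so
  \<open>\<alpha>'' = \<alpha> A\<^sup>2\<close> with \<open>A\<^sup>2\<close> symmetric, which is orthogonal to the tangent vectors \<open>\<alpha> S\<close>, \<open>S\<close> skew
  symmetric. Multiplying \<open>\<alpha> t = \<alpha> u\<close> by \<open>B h\<close> and separating the skew symmetric and the symmetric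
  part shows that \<open>\<alpha> t = \<alpha> u\<close> iff \<open>(t - u) \<zeta> h\<close> is a multiple of \<open>2\<pi>\<close> for every \<open>h\<close>.
  A nonzero \<open>t - u\<close> with this property exists iff the \<open>\<zeta> h\<close> are commensurable.
\<close>

section \<open>Matrix product, transpose and trace\<close>

text \<open>In finite dimension every bilinear map is bounded. The interpretation below then
  supplies the product rule and distributivity over sums for \<open>**\<close>.\<close>

lemma bounded_bilinear_matrix_mult:
  "bounded_bilinear ((**) :: real^'n^'m \<Rightarrow> real^'p^'n \<Rightarrow> real^'p^'m)"
  unfolding bilinear_conv_bounded_bilinear[symmetric] bilinear_def
  by (auto intro!: linearI simp: matrix_matrix_mult_def vec_eq_iff distrib_left distrib_right
      sum.distrib sum_distrib_left mult.assoc mult.left_commute)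

interpretation matrix_mult:
  bounded_bilinear "(**) :: real^'n^'m \<Rightarrow> real^'p^'n \<Rightarrow> real^'p^'m"
  by (rule bounded_bilinear_matrix_mult)

lemmas matrix_mult_linear =
  matrix_mult.add_left matrix_mult.add_right matrix_mult.diff_left matrix_mult.diff_right
  matrix_mult.minus_left matrix_mult.minus_right matrix_mult.zero_left matrix_mult.zero_right
  matrix_mult.scaleR_left matrix_mult.scaleR_right matrix_mult.sum_left matrix_mult.sum_right

lemma bounded_linear_transpose: "bounded_linear (transpose :: real^'n^'m \<Rightarrow> real^'m^'n)"
  unfolding linear_conv_bounded_linear[symmetric]
  by (intro linearI) (simp_all add: transpose_def vec_eq_iff)

lemmas has_vector_derivative_transpose =
  bounded_linear.has_vector_derivative[OF bounded_linear_transpose]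

text \<open>Both sides are the sum of the entrywise products. Definiteness of the metric thus comes
  from the inner product.\<close>

lemma frobenius_metric_eq_inner: "frobenius_metric V W = V \<bullet> W"
  unfolding frobenius_metric_def trace_def matrix_matrix_mult_def transpose_def inner_vec_def
  by (simp, rule sum.swap)

lemma trace_transpose: "trace (transpose M) = trace M"
  by (simp add: trace_def transpose_def)

text \<open>The trace is invariant under transposition and under swapping the two factors, so this
  trace equals its own negative.\<close>

lemma trace_symmetric_mult_skew:
  fixes P S :: "real^'n^'n"
  assumes "transpose P = P" and "skew_symmetric S"
  shows "trace (P ** S) = 0"
proof -
  have "trace (P ** S) = trace (transpose (P ** S))"
    by (simp add: trace_transpose)
  also have "\<dots> = trace (- (S ** P))"
    using assms by (simp add: matrix_transpose_mul skew_symmetric_def matrix_mult.minus_left)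
  also have "\<dots> = - trace (P ** S)"
    by (subst trace_mul_sym) (simp add: trace_def sum_negf)
  finally show ?thesis by simp
qed

section \<open>Tangent vectors and geodesics of the orthogonal group\<close>

text \<open>Differentiate \<open>transpose (c t) ** c t = mat 1\<close> at 0. This inclusion is
  enough for geodesics: an acceleration orthogonal to all such \<open>v\<close> is orthogonal to the
  tangent space.\<close>

lemma tangent_space_orthogonal_group:
  fixes Q :: "real^'n^'n"
  assumes "v \<in> tangent_space orthogonal_group Q"
  shows "skew_symmetric (transpose Q ** v)"
proof -
  from assms obtain c e where e: "e > 0" and c: "c ` {-e<..<e} \<subseteq> orthogonal_group" "c 0 = Q"
    and d: "(c has_vector_derivative v) (at 0)"
    by (auto simp: tangent_space_def smooth_curve_in_def)
  have "((\<lambda>t. transpose (c t) ** c t) has_vector_derivative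
      transpose (c 0) ** v + transpose v ** c 0) (at 0)"
    by (intro matrix_mult.has_vector_derivative has_vector_derivative_transpose d)
  moreover have "((\<lambda>t. transpose (c t) ** c t) has_vector_derivative 0) (at 0)"
  proof (rule has_vector_derivative_transform_within_open)
    show "((\<lambda>t. mat 1 :: real^'n^'n) has_vector_derivative 0) (at 0)" by simp
    show "mat 1 = transpose (c t) ** c t" if "t \<in> {-e<..<e}" for t
      using c(1) that by (force simp: orthogonal_group_def orthogonal_matrix_def)
  qed (use e in auto)
  ultimately have "transpose Q ** v + transpose v ** Q = 0"
    using c(2) vector_derivative_unique_at by blast
  then show ?thesis
    by (simp add: skew_symmetric_def matrix_transpose_mul eq_neg_iff_add_eq_0 add.commute)
qed

lemma zero_in_tangent_space:
  assumes "p \<in> M"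
  shows "0 \<in> tangent_space M p"
proof -
  have "smooth_curve_in M {-1<..<1} (\<lambda>_. p)"
    unfolding smooth_curve_in_def using assms
    by (auto intro!: exI[of _ "\<lambda>k _. if k = 0 then p else 0"])
  then show ?thesis
    unfolding tangent_space_def by (auto intro!: exI[of _ "\<lambda>_. p"] exI[of _ "1::real"])
qed

text \<open>The projection of a normal vector is 0. For uniqueness, any candidate \<open>w\<close>
  is itself tangent, so testing with \<open>u = w\<close> leaves
  \<open>w \<bullet> w = 0\<close>.\<close>

lemma covariant_derivative_eq_zero:
  fixes c :: "real \<Rightarrow> real^'n^'n"
  assumes "c t \<in> M"
    and "\<And>u. u \<in> tangent_space M (c t) \<Longrightarrow> frobenius_metric (vector_derivative X (at t)) u = 0"
  shows "covariant_derivative M frobenius_metric c X t = 0"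
  unfolding covariant_derivative_def
proof (rule the_equality)
  show "0 \<in> tangent_space M (c t) \<and>
      (\<forall>u\<in>tangent_space M (c t). frobenius_metric (vector_derivative X (at t) - 0) u = 0)"
    using assms zero_in_tangent_space by auto
next
  fix w
  assume "w \<in> tangent_space M (c t) \<and>
      (\<forall>u\<in>tangent_space M (c t). frobenius_metric (vector_derivative X (at t) - w) u = 0)"
  then have "w \<bullet> w = 0"
    using assms(2)[of w] by (auto simp: frobenius_metric_eq_inner inner_diff_left)
  then show "w = 0" by simp
qed

text \<open>The derivative of \<open>c t ** transpose (c t)\<close> is
  \<open>c t ** (transpose A + A) ** transpose (c t)\<close>, which vanishes, so the product keeps
  its initial value.\<close>

lemma orthogonal_curve:
  fixes c :: "real \<Rightarrow> real^'n^'n"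
  assumes A: "skew_symmetric A"
    and c: "\<And>t. (c has_vector_derivative c t ** A) (at t)"
    and "c 0 \<in> orthogonal_group"
  shows "c t \<in> orthogonal_group"
proof -
  have "((\<lambda>t. c t ** transpose (c t)) has_derivative (\<lambda>h. 0)) (at t)" for t
  proof -
    have "((\<lambda>t. c t ** transpose (c t)) has_vector_derivative
        c t ** transpose (c t ** A) + (c t ** A) ** transpose (c t)) (at t)"
      by (intro matrix_mult.has_vector_derivative has_vector_derivative_transpose c)
    also have "c t ** transpose (c t ** A) + (c t ** A) ** transpose (c t) = 0"
      using A by (simp add: skew_symmetric_def matrix_transpose_mul matrix_mult_linear
          matrix_mul_assoc)
    finally show ?thesis by (simp add: has_vector_derivative_def)
  qed
  then have "c t ** transpose (c t) = c 0 ** transpose (c 0)"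
    by (intro has_derivative_zero_unique[of UNIV "\<lambda>t. c t ** transpose (c t)" t 0]) auto
  also have "\<dots> = mat 1"
    using assms(3) by (simp add: orthogonal_group_def orthogonal_matrix_def)
  finally show ?thesis
    by (simp add: orthogonal_group_def orthogonal_matrix_def matrix_left_right_inverse)
qed

lemma geodesic_orthogonal_group:
  fixes c :: "real \<Rightarrow> real^'n^'n"
  assumes A: "skew_symmetric A"
    and c: "\<And>t. (c has_vector_derivative c t ** A) (at t)"
    and c0: "c 0 \<in> orthogonal_group"
  shows "geodesic orthogonal_group frobenius_metric c"
proof -
  have mem: "c t \<in> orthogonal_group" for t
    by (rule orthogonal_curve[OF A c c0])
  have der: "((\<lambda>t. c t ** P) has_vector_derivative c t ** A ** P) (at t)"
    for t and P :: "real^'n^'n"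
  proof -
    have "((\<lambda>t. c t ** P) has_vector_derivative c t ** 0 + (c t ** A) ** P) (at t)"
      by (intro matrix_mult.has_vector_derivative c has_vector_derivative_const)
    then show ?thesis by (simp add: matrix_mult_linear)
  qed
  \<comment> \<open>Each differentiation inserts a factor \<open>A\<close> directly after
    \<open>c t\<close>, which is where the recursion of \<open>matrix_power\<close> puts it.\<close>
  have "smooth_curve_in orthogonal_group UNIV c"
    unfolding smooth_curve_in_def using mem der
    by (auto intro!: exI[of _ "\<lambda>k t. c t ** matrix_power A k"] simp: matrix_mul_assoc)
  moreover have "covariant_derivative orthogonal_group frobenius_metric c
      (\<lambda>r. vector_derivative c (at r)) t = 0" for t
  proof (rule covariant_derivative_eq_zero[OF mem])
    fix u assume "u \<in> tangent_space orthogonal_group (c t)"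
    then have S: "skew_symmetric (transpose (c t) ** u)"
      by (rule tangent_space_orthogonal_group)
    have "vector_derivative (\<lambda>r. vector_derivative c (at r)) (at t) = c t ** A ** A"
      using der[of A t] by (simp add: vector_derivative_at[OF c] vector_derivative_at)
    \<comment> \<open>The two signs of \<open>transpose A = - A\<close> cancel, and
      \<open>transpose (c t)\<close> ends up next to \<open>u\<close>, forming the skew symmetric
      factor.\<close>
    moreover have "transpose (c t ** A ** A) ** u = A ** A ** (transpose (c t) ** u)"
      using A by (simp add: skew_symmetric_def matrix_transpose_mul matrix_mult_linear
          matrix_mul_assoc)
    moreover have "transpose (A ** A) = A ** A"
      using A by (simp add: skew_symmetric_def matrix_transpose_mul matrix_mult_linear)
    ultimately show "frobenius_metric (vector_derivative (\<lambda>r. vector_derivative c (at r)) (at t)) u = 0"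
      using trace_symmetric_mult_skew[OF _ S] by (simp add: frobenius_metric_def)
  qed
  ultimately show ?thesis by (simp add: geodesic_def)
qed

section \<open>Skew symmetric and symmetric parts, and the algebra of the decomposition\<close>

lemma skew_symmetric_add_symmetric_eq_zero:
  fixes P S :: "real^'n^'n"
  assumes "skew_symmetric S" "transpose P = P" "S + P = 0"
  shows "S = 0" "P = 0"
proof -
  interpret linear "transpose :: real^'n^'n \<Rightarrow> real^'n^'n"
    by (rule bounded_linear.linear[OF bounded_linear_transpose])
  have "P - S = transpose (S + P)"
    using assms(1,2) by (simp add: add skew_symmetric_def)
  then have "P = S"
    using assms(3) by (simp add: zero)
  then have "2 *\<^sub>R S = 0"
    using assms(3) by (simp add: scaleR_2)
  with \<open>P = S\<close> show "S = 0" "P = 0"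
    by simp_all
qed

locale skew_svd_decomposition =
  fixes A :: "real^'n^'n" and s :: nat and z :: "nat \<Rightarrow> real" and B :: "nat \<Rightarrow> real^'n^'n"
  assumes svd: "skew_svd A s z B"
begin

lemma
  assumes "h \<in> {1..s}"
  shows z_pos: "z h > 0"
    and B_nonzero: "B h \<noteq> 0"
    and B_skew: "skew_symmetric (B h)"
    and B_cube: "B h ** B h ** B h = - B h"
proof -
  have "singular_value A (z h) \<and> z h \<noteq> 0"
    using svd assms unfolding skew_svd_def by blast
  then show "z h > 0" by (simp add: singular_value_def)
qed (use svd assms in \<open>auto simp: skew_svd_def\<close>)

lemma A_eq: "A = (\<Sum>j=1..s. z j *\<^sub>R B j)"
  using svd by (simp add: skew_svd_def)

text \<open>Right multiplication by \<open>B h\<close> kills every term with another index, and the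
  cube relation turns the square term into a multiple of \<open>B h\<close>. This isolates a single
  singular value.\<close>

lemma sum_mult_B:
  assumes "h \<in> {1..s}"
  shows "(\<Sum>j=1..s. a j *\<^sub>R B j + b j *\<^sub>R (B j ** B j)) ** B h = a h *\<^sub>R (B h ** B h) - b h *\<^sub>R B h"
proof -
  have "(a j *\<^sub>R B j + b j *\<^sub>R (B j ** B j)) ** B h =
      (if j = h then a h *\<^sub>R (B h ** B h) - b h *\<^sub>R B h else 0)" if "j \<in> {1..s}" for j
  proof (cases "j = h")
    case True
    then show ?thesis using B_cube[OF assms] by (simp add: matrix_mult_linear)
  next
    case False
    then have "B j ** B h = 0" using svd assms that by (auto simp: skew_svd_def)
    then show ?thesis using False by (simp add: matrix_mult_linear matrix_mul_assoc[symmetric])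
  qed
  then show ?thesis using assms by (simp add: matrix_mult.sum_left)
qed

lemma A_mult_B: "h \<in> {1..s} \<Longrightarrow> A ** B h = z h *\<^sub>R (B h ** B h)"
  using sum_mult_B[of h z "\<lambda>_. 0"] by (simp add: A_eq)

lemma A_mult_B_B: "h \<in> {1..s} \<Longrightarrow> A ** (B h ** B h) = - z h *\<^sub>R B h"
  by (simp add: matrix_mul_assoc A_mult_B matrix_mult_linear B_cube)

section \<open>Closed form of the exponential and its derivative\<close>

text \<open>A Rodrigues formula for the exponential of \<open>t *\<^sub>R A\<close>: on the range of
  \<open>B j\<close> it turns by the angle \<open>t * z j\<close>.\<close>

definition rotation :: "real \<Rightarrow> real^'n^'n" where
  "rotation t = mat 1 + (\<Sum>j=1..s. sin (t * z j) *\<^sub>R B j + (1 - cos (t * z j)) *\<^sub>R (B j ** B j))"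

text \<open>The exponential series is compared with the sine and cosine series term by term. The
  conditionals on \<open>k = 0\<close> carry the constants \<open>mat 1\<close> and the 1 of
  \<open>1 - cos\<close>.\<close>

lemma exp_series_term:
  "(1 / fact k) *\<^sub>R matrix_power (t *\<^sub>R A) k = (if k = 0 then mat 1 else 0) +
     (\<Sum>j=1..s. (sin_coeff k *\<^sub>R (t * z j) ^ k) *\<^sub>R B j +
       ((if k = 0 then 1 else 0) - cos_coeff k *\<^sub>R (t * z j) ^ k) *\<^sub>R (B j ** B j))"
proof (induction k)
  case 0
  show ?case by simp
next
  case (Suc k)
  have "(1 / fact (Suc k)) *\<^sub>R matrix_power (t *\<^sub>R A) (Suc k) =
      (t / Suc k) *\<^sub>R (A ** ((1 / fact k) *\<^sub>R matrix_power (t *\<^sub>R A) k))"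
    by (simp add: matrix_mult_linear)
  also have "\<dots> = (t / Suc k) *\<^sub>R (if k = 0 then A else 0) +
      (\<Sum>j=1..s. (t / Suc k) *\<^sub>R ((sin_coeff k *\<^sub>R (t * z j) ^ k) *\<^sub>R (A ** B j) +
       ((if k = 0 then 1 else 0) - cos_coeff k *\<^sub>R (t * z j) ^ k) *\<^sub>R (A ** (B j ** B j))))"
    unfolding Suc.IH by (simp add: matrix_mult_linear scaleR_add_right scaleR_sum_right)
  \<comment> \<open>For \<open>k = 0\<close> the identity contributes a term \<open>A\<close>.
    Expanding it over the \<open>B j\<close> puts everything under one sum, to be compared index by
    index.\<close>
  also have "\<dots> = (\<Sum>j=1..s. (t / Suc k) *\<^sub>R ((if k = 0 then z j *\<^sub>R B j else 0) +
       ((sin_coeff k *\<^sub>R (t * z j) ^ k) *\<^sub>R (A ** B j) +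
       ((if k = 0 then 1 else 0) - cos_coeff k *\<^sub>R (t * z j) ^ k) *\<^sub>R (A ** (B j ** B j)))))"
    by (simp add: A_eq scaleR_add_right scaleR_sum_right sum.distrib)
  also have "\<dots> = (\<Sum>j=1..s. (sin_coeff (Suc k) *\<^sub>R (t * z j) ^ Suc k) *\<^sub>R B j +
       (- cos_coeff (Suc k) *\<^sub>R (t * z j) ^ Suc k) *\<^sub>R (B j ** B j))"
  proof (intro sum.cong refl)
    fix j assume "j \<in> {1..s}"
    note A_mult = A_mult_B[OF this] A_mult_B_B[OF this]
    show "(t / Suc k) *\<^sub>R ((if k = 0 then z j *\<^sub>R B j else 0) +
       ((sin_coeff k *\<^sub>R (t * z j) ^ k) *\<^sub>R (A ** B j) +
       ((if k = 0 then 1 else 0) - cos_coeff k *\<^sub>R (t * z j) ^ k) *\<^sub>R (A ** (B j ** B j)))) =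
       (sin_coeff (Suc k) *\<^sub>R (t * z j) ^ Suc k) *\<^sub>R B j +
       (- cos_coeff (Suc k) *\<^sub>R (t * z j) ^ Suc k) *\<^sub>R (B j ** B j)"
      unfolding A_mult sin_coeff_Suc cos_coeff_Suc
      \<comment> \<open>For \<open>k = 0\<close> the coefficient of \<open>B j ** B j\<close> is
        \<open>1 - 1 = 0\<close>, and the linear sine term comes from the identity alone.\<close>
      by (cases "k = 0") (simp_all add: algebra_simps)
  qed
  finally show ?case by simp
qed

lemma matrix_exp_eq_rotation: "matrix_exp (t *\<^sub>R A) = rotation t"
proof -
  have zero: "(\<lambda>k. if k = 0 then a else 0) sums a" for a :: "'a::real_normed_vector"
    using sums_single[of 0 "\<lambda>_. a"] by (simp add: eq_commute)
  have "(\<lambda>k. (1 / fact k) *\<^sub>R matrix_power (t *\<^sub>R A) k) sums rotation t"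
    unfolding exp_series_term rotation_def
    by (intro sums_add sums_sum bounded_linear.sums[OF bounded_linear_scaleR_left] sums_diff
        sin_converges cos_converges zero)
  then show ?thesis by (simp add: matrix_exp_def sums_iff)
qed

text \<open>Expanding the right factor \<open>A\<close> and applying \<open>sum_mult_B\<close> for
  each index gives exactly the termwise derivative of \<open>rotation\<close>, so the series itself
  is never differentiated.\<close>

lemma rotation_mult_A: "rotation t ** A =
    (\<Sum>j=1..s. (z j * cos (t * z j)) *\<^sub>R B j + (z j * sin (t * z j)) *\<^sub>R (B j ** B j))"
proof -
  have "rotation t ** A = A + (\<Sum>h=1..s. z h *\<^sub>R
      ((\<Sum>j=1..s. sin (t * z j) *\<^sub>R B j + (1 - cos (t * z j)) *\<^sub>R (B j ** B j)) ** B h))"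
    unfolding rotation_def matrix_mult.add_left matrix_mul_lid matrix_mult.scaleR_right[symmetric]
      matrix_mult.sum_right[symmetric] A_eq[symmetric] ..
  also have "\<dots> = (\<Sum>h=1..s. z h *\<^sub>R B h) +
      (\<Sum>h=1..s. z h *\<^sub>R (sin (t * z h) *\<^sub>R (B h ** B h) - (1 - cos (t * z h)) *\<^sub>R B h))"
    by (intro arg_cong2[where f = "(+)"] A_eq sum.cong refl) (simp only: sum_mult_B)
  also have "\<dots> = (\<Sum>j=1..s. (z j * cos (t * z j)) *\<^sub>R B j + (z j * sin (t * z j)) *\<^sub>R (B j ** B j))"
    unfolding sum.distrib[symmetric] by (intro sum.cong refl) (simp add: algebra_simps)
  finally show ?thesis .
qed

lemma rotation_has_vector_derivative: "(rotation has_vector_derivative rotation t ** A) (at t)"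
proof -
  have "((\<lambda>t. mat 1 + (\<Sum>j=1..s. sin (t * z j) *\<^sub>R B j + (1 - cos (t * z j)) *\<^sub>R (B j ** B j)))
      has_vector_derivative
      0 + (\<Sum>j=1..s. (z j * cos (t * z j)) *\<^sub>R B j + (z j * sin (t * z j)) *\<^sub>R (B j ** B j))) (at t)"
    by (auto intro!: derivative_eq_intros has_vector_derivative_add has_vector_derivative_sum
        simp: mult.commute)
  then show ?thesis
    unfolding rotation_mult_A by (simp add: rotation_def[abs_def])
qed

section \<open>Coincidences and periods\<close>

lemma rotation_eq_iff:
  "rotation t = rotation u \<longleftrightarrow> (\<forall>h\<in>{1..s}. \<exists>n::int. t * z h = u * z h + 2 * pi * n)"
proof
  assume eq: "rotation t = rotation u"
  show "\<forall>h\<in>{1..s}. \<exists>n::int. t * z h = u * z h + 2 * pi * n"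
  proof
    fix h assume h: "h \<in> {1..s}"
    let ?p = "sin (t * z h) - sin (u * z h)" and ?q = "cos (t * z h) - cos (u * z h)"
    have "(\<Sum>j=1..s. sin (t * z j) *\<^sub>R B j + (1 - cos (t * z j)) *\<^sub>R (B j ** B j)) ** B h =
        (\<Sum>j=1..s. sin (u * z j) *\<^sub>R B j + (1 - cos (u * z j)) *\<^sub>R (B j ** B j)) ** B h"
      using eq by (simp add: rotation_def)
    \<comment> \<open>Multiplication by \<open>B h\<close> has exchanged the roles: the cosines now
      go with the skew symmetric \<open>B h\<close>, the sines with its symmetric square.\<close>
    then have "?q *\<^sub>R B h + ?p *\<^sub>R (B h ** B h) = 0"
      unfolding sum_mult_B[OF h] by (simp add: algebra_simps)
    moreover have "skew_symmetric (?q *\<^sub>R B h)" "transpose (?p *\<^sub>R (B h ** B h)) = ?p *\<^sub>R (B h ** B h)"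
      using B_skew[OF h]
      by (simp_all add: skew_symmetric_def transpose_scalar matrix_transpose_mul matrix_mult_linear)
    ultimately have "?q *\<^sub>R B h = 0" "?p *\<^sub>R (B h ** B h) = 0"
      by (auto dest: skew_symmetric_add_symmetric_eq_zero)
    \<comment> \<open>A vanishing square would give \<open>B h = 0\<close> by the cube relation.
      Hence both scalar coefficients vanish.\<close>
    moreover have "B h ** B h \<noteq> 0"
      using B_cube[OF h] B_nonzero[OF h] by (auto simp: matrix_mult_linear)
    ultimately have "sin (t * z h) = sin (u * z h) \<and> cos (t * z h) = cos (u * z h)"
      using B_nonzero[OF h] by simp
    then show "\<exists>n::int. t * z h = u * z h + 2 * pi * n"
      by (simp only: sin_cos_eq_iff)
  qed
next
  assume "\<forall>h\<in>{1..s}. \<exists>n::int. t * z h = u * z h + 2 * pi * n"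
  then have "sin (t * z h) = sin (u * z h)" "cos (t * z h) = cos (u * z h)" if "h \<in> {1..s}" for h
    using that sin_cos_eq_iff by blast+
  then show "rotation t = rotation u"
    by (simp add: rotation_def)
qed

lemma inj_rotation:
  assumes jh: "j \<in> {1..s}" "h \<in> {1..s}" and irrational: "z j / z h \<notin> \<rat>"
  shows "inj rotation"
proof (rule injI, rule ccontr)
  fix t u assume "rotation t = rotation u" and "t \<noteq> u"
  then obtain m n :: int where "t * z j = u * z j + 2 * pi * m" "t * z h = u * z h + 2 * pi * n"
    using jh unfolding rotation_eq_iff by metis
  then have mn: "(t - u) * z j = 2 * pi * m" "(t - u) * z h = 2 * pi * n"
    by (simp_all add: algebra_simps)
  have "z j / z h = ((t - u) * z j) / ((t - u) * z h)"
    using \<open>t \<noteq> u\<close> by simp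
  \<comment> \<open>The case \<open>n = 0\<close> needs no separate treatment, since division by
    zero gives the rational number 0.\<close>
  also have "\<dots> = m / n"
    unfolding mn by simp
  finally show False
    using irrational by simp
qed

lemma rotation_periodic:
  assumes "\<forall>j\<in>{1..s}. \<forall>h\<in>{1..s}. z j / z h \<in> \<rat>"
  obtains T where "T > 0" "\<And>t. rotation (t + T) = rotation t"
\<comment> \<open>Without singular values there is no reference \<open>z 1\<close>, but
  \<open>rotation\<close> is constant and any period works.\<close>
proof (cases "s = 0")
  case True
  have "rotation (t + 1) = rotation t" for t
    unfolding rotation_eq_iff using True by simp
  then show ?thesis using that[of 1] by simp
next
  case False
  then have z1: "z 1 > 0" by (intro z_pos) auto
  have "\<forall>j\<in>{1..s}. \<exists>q::nat. q > (0::nat) \<and> z j / z 1 * q \<in> \<int>"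
  proof
    fix j assume "j \<in> {1..s}"
    then have "z j / z 1 \<in> \<rat>" using assms False by simp
    then obtain p :: int and q :: nat where "q > 0" "z j / z 1 = p / q"
      by (auto simp: Rats_eq_int_div_nat)
    then show "\<exists>q::nat. q > (0::nat) \<and> z j / z 1 * q \<in> \<int>"
      by (intro exI[of _ q]) simp
  qed
  then obtain q :: "nat \<Rightarrow> nat"
    where q: "\<And>j. j \<in> {1..s} \<Longrightarrow> q j > (0::nat) \<and> z j / z 1 * q j \<in> \<int>"
    by metis
  \<comment> \<open>The product of the denominators of all \<open>z j / z 1\<close> is a common
    multiple of them, so every angle \<open>T * z j\<close> is a multiple of \<open>2 * pi\<close>.
    The period need not be minimal.\<close>
  define T where "T = 2 * pi * (\<Prod>j=1..s. q j) / z 1"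
  have "T > 0"
    using z1 q by (auto simp: T_def intro!: divide_pos_pos mult_pos_pos prod_pos)
  moreover have "rotation (t + T) = rotation t" for t
    unfolding rotation_eq_iff
  proof
    fix h assume h: "h \<in> {1..s}"
    define P where "P = (\<Prod>j\<in>{1..s}-{h}. q j)"
    have "z h / z 1 * q h * of_nat P \<in> \<int>"
      by (rule Ints_mult[OF conjunct2[OF q[OF h]]]) simp
    then obtain n :: int where n: "z h / z 1 * q h * of_nat P = of_int n"
      by (auto elim: Ints_cases)
    have "(\<Prod>j=1..s. q j) = q h * P"
      using h unfolding P_def by (intro prod.remove) auto
    then have "T * z h = 2 * pi * (z h / z 1 * q h * of_nat P)"
      unfolding T_def by simp
    then have "T * z h = 2 * pi * n"
      unfolding n .
    then show "\<exists>n::int. (t + T) * z h = t * z h + 2 * pi * n"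
      by (auto simp: algebra_simps)
  qed
  ultimately show ?thesis using that by blast
qed

end

section \<open>The geodesic through \<open>G\<close>\<close>

theorem proposition4p10:
  fixes G A :: "real^'n^'n"
    and s :: nat
    and \<zeta> :: "nat \<Rightarrow> real"
    and B :: "nat \<Rightarrow> real^'n^'n"
    and \<alpha> :: "real \<Rightarrow> real^'n^'n"
  assumes "G \<in> orthogonal_group"
    and "skew_symmetric A" and "A \<noteq> 0"
    and "\<And>j. j \<in> {1..s} \<Longrightarrow> \<zeta> j > 0" and "inj_on \<zeta> {1..s}"
    and "{c. eigenvalue (complexify A) c \<and> c \<noteq> 0} =
           (\<Union>j\<in>{1..s}. {\<i> * complex_of_real (\<zeta> j), - (\<i> * complex_of_real (\<zeta> j))})"
    and "skew_svd A s \<zeta> B"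
    and "\<alpha> = (\<lambda>t. G ** matrix_exp (t *\<^sub>R A))"
  shows "(\<forall>t. \<alpha> t = G + (\<Sum>j=1..s. sin (t * \<zeta> j) *\<^sub>R (G ** B j)
                              + (1 - cos (t * \<zeta> j)) *\<^sub>R (G ** (B j ** B j)))) \<and>
         geodesic orthogonal_group frobenius_metric \<alpha> \<and> \<not> \<alpha> constant_on UNIV \<and>
         ((\<exists>j\<in>{1..s}. \<exists>h\<in>{1..s}. \<zeta> j / \<zeta> h \<notin> \<rat>) \<longrightarrow> injective_immersion orthogonal_group \<alpha>) \<and>
         ((\<forall>j\<in>{1..s}. \<forall>h\<in>{1..s}. \<zeta> j / \<zeta> h \<in> \<rat>) \<longrightarrow>
            closed_geodesic orthogonal_group frobenius_metric \<alpha>)"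
proof -
  interpret skew_svd_decomposition A s \<zeta> B
    by unfold_locales (fact assms(7))
  have \<alpha>: "\<alpha> = (\<lambda>t. G ** rotation t)"
    using assms(8) by (simp add: matrix_exp_eq_rotation)
  have formula: "\<alpha> t = G + (\<Sum>j=1..s. sin (t * \<zeta> j) *\<^sub>R (G ** B j)
      + (1 - cos (t * \<zeta> j)) *\<^sub>R (G ** (B j ** B j)))" for t
    by (simp add: \<alpha> rotation_def matrix_mult_linear)
  \<comment> \<open>Left multiplication by the constant \<open>G\<close> preserves the differential
    equation, since \<open>A\<close> acts on the right.\<close>
  have der: "(\<alpha> has_vector_derivative \<alpha> t ** A) (at t)" for t
    using matrix_mult.has_vector_derivative[OF has_vector_derivative_const
        rotation_has_vector_derivative, of G t]
    by (simp add: \<alpha> matrix_mult_linear matrix_mul_assoc)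
  have \<alpha>0: "\<alpha> 0 \<in> orthogonal_group"
    using assms(1) by (simp add: \<alpha> rotation_def)
  have cancel: "P = Q" if "M ** P = M ** Q" "M \<in> orthogonal_group" for M P Q :: "real^'n^'n"
    using that by (metis matrix_mul_assoc matrix_mul_lid mem_Collect_eq orthogonal_group_def
        orthogonal_matrix_def)
  \<comment> \<open>\<open>\<alpha> t\<close> is orthogonal, hence cancellable, and \<open>A\<close>
    is nonzero. This yields both nonconstancy and the immersion property.\<close>
  have velocity: "\<alpha> t ** A \<noteq> 0" for t
    using cancel[of "\<alpha> t" A 0] orthogonal_curve[OF assms(2) der \<alpha>0] assms(3)
    by (auto simp: matrix_mult_linear)
  have geod: "geodesic orthogonal_group frobenius_metric \<alpha>"
    by (rule geodesic_orthogonal_group[OF assms(2) der \<alpha>0])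
  have "\<not> \<alpha> constant_on UNIV"
  proof
    assume "\<alpha> constant_on UNIV"
    then obtain C where "\<alpha> = (\<lambda>_. C)" by (auto simp: constant_on_def)
    then have "(\<alpha> has_vector_derivative 0) (at 0)" by simp
    then show False
      using vector_derivative_unique_at[OF der[of 0]] velocity[of 0] by auto
  qed
  moreover have "injective_immersion orthogonal_group \<alpha>"
    if "\<exists>j\<in>{1..s}. \<exists>h\<in>{1..s}. \<zeta> j / \<zeta> h \<notin> \<rat>"
  proof -
    have "inj rotation" using that inj_rotation by blast
    then have "inj \<alpha>"
      using cancel[OF _ assms(1)] by (auto simp: inj_def \<alpha>)
    moreover have "inj (frechet_derivative \<alpha> (at t))" for t
    proof -
      \<comment> \<open>On a one-dimensional domain the derivative is scaling of the velocity, so it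
        is injective because the velocity is nonzero.\<close>
      have "frechet_derivative \<alpha> (at t) = (\<lambda>h. h *\<^sub>R (\<alpha> t ** A))"
        using der[of t] by (metis frechet_derivative_at has_vector_derivative_def)
      then show ?thesis using velocity by (auto simp: inj_def)
    qed
    ultimately show ?thesis
      using geod by (simp add: injective_immersion_def geodesic_def)
  qed
  moreover have "closed_geodesic orthogonal_group frobenius_metric \<alpha>"
    if rational: "\<forall>j\<in>{1..s}. \<forall>h\<in>{1..s}. \<zeta> j / \<zeta> h \<in> \<rat>"
  proof -
    obtain T where "T > 0" "\<And>t. rotation (t + T) = rotation t"
      using rotation_periodic[OF rational] by blast
    then show ?thesis using geod by (auto simp: closed_geodesic_def \<alpha>)
  qed
  ultimately show ?thesis using formula geod by blast
qed

end
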